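(* Let $(\Sigma)$: $\dot g=\mathcal X(g)+\sum_{j=1}^m u_jB_j(g)$ be a linear system on the generalized Heisenberg group $\mathbb{H}^n$, let $D$ be the derivation associated to $\mathcal X$, let $Z$ be a generator of the center of $\mathfrak h^n$, and let $d\in\mathbb R$ be defined by $DZ=dZ$. Assume that $Z$ does not belong to the Lie subalgebra of $\mathfrak h^n$ generated by $B_1,\dots,B_m$ and that $d\neq 0$. Choose a symplectic basis $(X_1,Y_1,\dots,X_n,Y_n,Z)$ such that all the $B_j$'s belong to $\mathrm{Span}\{X_1,\dots,X_n\}$, with associated coordinates $(x_1,y_1,\dots,x_n,y_n,z)$, so that the last coordinate satisfies along $(\Sigma)$ a control-independent equation $$\dot z=dz+l(x_1,y_1,\dots,x_n,y_n)+Q(x_1,y_1,\dots,x_n,y_n),$$ where $l$ is a linear form and $Q$ a quadratic form on $\mathbb R^{2n}$. If $Q$ is non negative and $\ker(Q)\subset\ker(l)$, then $(\Sigma)$ is not controllable.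
   Context: $\mathbb{H}^n$ is the $(2n+1)$-dimensional simply connected Lie group of real $(n+2)\times(n+2)$ upper triangular matrices with ones on the diagonal, first row $(1,y_1,\dots,y_n,z)$, last column $(z,x_1,\dots,x_n,1)^T$, and all other off-diagonal entries $0$. Its Lie algebra $\mathfrak h^n$ (the right-invariant vector fields) has basis $X_i=\partial/\partial x_i$, $Y_i=\partial/\partial y_i+x_i\,\partial/\partial z$ $(1\le i\le n)$, $Z=\partial/\partial z$, with $[X_i,Y_i]=Z$ and all other brackets zero; its center is $\mathbb RZ$, equal to the derived algebra. A vector field $\mathcal X$ on a connected Lie group $G$ is linear if its flow is a one-parameter group of automorphisms of $G$; the associated derivation of the Lie algebra (of right-invariant vector fields) is $D=-\mathrm{ad}(\mathcal X)$. A linear system is a control system $\dot g=\mathcal X(g)+\sum_{j=1}^m u_jB_j(g)$ with $\mathcal X$ linear, the $B_j$ right-invariant, and inputs $u=(u_1,\dots,u_m)$ measurable, locally bounded, with values in $\mathbb R^m$. It is controllable if for all $g,h\in G$ some input steers $g$ to $h$ in some time $T\ge 0$. A basis $(X_1,Y_1,\dots,X_n,Y_n,Z)$ of $\mathfrak h^n$ (with $Z$ any generator of the center) is symplectic if $[X_i,Y_i]=Z$ for $i=1,\dots,n$ and all other brackets of basis elements vanish. To any symplectic basis are associated global coordinates on $\mathbb H^n$, vanishing at the identity, in which $X_i=\partial/\partial x_i$, $Y_i=\partial/\partial y_i+x_i\,\partial/\partial z$, $Z=\partial/\partial z$ (the transform of the canonical coordinates by a group automorphism). The kernel of a quadratic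 form is the kernel of its associated symmetric bilinear form. *)

theory Defs
  imports "HOL-Analysis.Analysis" "HOL-Library.Function_Algebras"
begin

text \<open>Vector fields are maps from a space to itself, with the pointwise real vector space
  structure.\<close>

instantiation "fun" :: (type, real_vector) real_vector
begin

definition "r *\<^sub>R f = (\<lambda>x. r *\<^sub>R f x)"

instance
  by standard (simp_all add: scaleR_fun_def fun_eq_iff scaleR_add_right scaleR_add_left)

end

lemma scaleR_fun_apply [simp]: "(r *\<^sub>R f) x = r *\<^sub>R f x"
  unfolding scaleR_fun_def ..

text \<open>On a finite-dimensional space, \<open>f\<close> is of class \<open>C\<^sup>k\<^sup>+\<^sup>1\<close> iff it is differentiable and all its
  directional derivatives are of class \<open>C\<^sup>k\<close>.\<close>

primrec C_class :: "nat \<Rightarrow> ('a::euclidean_space \<Rightarrow> 'b::euclidean_space) \<Rightarrow> bool" where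
  "C_class 0 f \<longleftrightarrow> continuous_on UNIV f"
| "C_class (Suc k) f \<longleftrightarrow>
     (\<forall>p. f differentiable (at p)) \<and> (\<forall>v. C_class k (\<lambda>p. frechet_derivative f (at p) v))"

definition smooth :: "('a::euclidean_space \<Rightarrow> 'b::euclidean_space) \<Rightarrow> bool" where
  "smooth f \<longleftrightarrow> (\<forall>k. C_class k f)"


text \<open>The matrix with first row \<open>(1, y, z)\<close> and last column \<open>(z, x, 1)\<close> is represented by the
  triple \<open>(x, y, z)\<close>. This is a global chart, and the identity matrix is \<open>0\<close>. Beware that \<open>+\<close> on
  triples is the addition of the chart (and of tangent vectors); the group law is \<open>heis_mult\<close>.\<close>

type_synonym 'n heis = "(real^'n) \<times> (real^'n) \<times> real"

definition heis_matrix :: "'n::finite heis \<Rightarrow> real^(unit + 'n + unit)^(unit + 'n + unit)" where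
  "heis_matrix = (\<lambda>(x, y, z). \<chi> i j. case (i, j) of
       (Inl _, Inr (Inl k)) \<Rightarrow> y $ k
     | (Inl _, Inr (Inr _)) \<Rightarrow> z
     | (Inr (Inl k), Inr (Inr _)) \<Rightarrow> x $ k
     | _ \<Rightarrow> if i = j then 1 else 0)"

definition heis_mult :: "'n::finite heis \<Rightarrow> 'n heis \<Rightarrow> 'n heis" where
  "heis_mult = (\<lambda>(x, y, z) (x', y', z'). (x + x', y + y', z + z' + y \<bullet> x'))"

lemma sum_UNIV_Plus:
  fixes f :: "('a::finite + 'b::finite) \<Rightarrow> real"
  shows "sum f UNIV = (\<Sum>a\<in>UNIV. f (Inl a)) + (\<Sum>b\<in>UNIV. f (Inr b))"
  by (simp add: UNIV_Plus_UNIV [symmetric] sum.Plus del: UNIV_Plus_UNIV)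

lemma heis_matrix_zero: "heis_matrix 0 = mat 1"
  by (auto simp: heis_matrix_def mat_def vec_eq_iff zero_prod_def split: sum.splits)

lemma heis_matrix_mult: "heis_matrix (heis_mult g h) = heis_matrix g ** heis_matrix h"
proof -
  have delta: "(\<Sum>k\<in>UNIV. (if i = k then 1 else 0) * f k) = f i"
    "(\<Sum>k\<in>UNIV. f k * (if k = i then 1 else 0)) = f i" for i :: 'a and f :: "'a \<Rightarrow> real"
    by (simp_all add: if_distrib if_distribR cong: if_cong)
  show ?thesis
    by (cases g; cases h)
       (auto simp: heis_matrix_def heis_mult_def matrix_matrix_mult_def vec_eq_iff sum_UNIV_Plus
          UNIV_unit inner_vec_def delta split: sum.splits)
qed

text \<open>Automorphisms of \<open>\<HH>\<^sup>n\<close> as a Lie group.\<close>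

definition heis_automorphism :: "('n::finite heis \<Rightarrow> 'n heis) \<Rightarrow> bool" where
  "heis_automorphism f \<longleftrightarrow>
     bij f \<and> smooth f \<and> smooth (inv f) \<and> (\<forall>g h. f (heis_mult g h) = heis_mult (f g) (f h))"


text \<open>The Lie bracket is that of vector fields seen as derivations, \<open>[V, W] = V W - W V\<close>; with this
  sign \<open>[\<partial>/\<partial>x\<^sub>i, \<partial>/\<partial>y\<^sub>i + x\<^sub>i \<partial>/\<partial>z] = \<partial>/\<partial>z\<close>.\<close>

definition lie_bracket ::
    "('a::euclidean_space \<Rightarrow> 'a) \<Rightarrow> ('a \<Rightarrow> 'a) \<Rightarrow> ('a \<Rightarrow> 'a)" where
  "lie_bracket V W =
     (\<lambda>g. frechet_derivative W (at g) (V g) - frechet_derivative V (at g) (W g))"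

definition right_invariant :: "('n::finite heis \<Rightarrow> 'n heis) \<Rightarrow> bool" where
  "right_invariant V \<longleftrightarrow>
     (\<forall>g h. V (heis_mult h g) = frechet_derivative (\<lambda>k. heis_mult k g) (at h) (V h))"

definition heis_algebra :: "('n::finite heis \<Rightarrow> 'n heis) set" where
  "heis_algebra = {V. right_invariant V}"

definition heis_center :: "('n::finite heis \<Rightarrow> 'n heis) set" where
  "heis_center = {V \<in> heis_algebra. \<forall>W \<in> heis_algebra. lie_bracket V W = 0}"

definition lie_subalgebra :: "('n::finite heis \<Rightarrow> 'n heis) set \<Rightarrow> bool" where
  "lie_subalgebra S \<longleftrightarrow>
     S \<subseteq> heis_algebra \<and> subspace S \<and> (\<forall>V \<in> S. \<forall>W \<in> S. lie_bracket V W \<in> S)"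


definition linear_vector_field :: "('n::finite heis \<Rightarrow> 'n heis) \<Rightarrow> bool" where
  "linear_vector_field \<X> \<longleftrightarrow> smooth \<X> \<and>
     (\<exists>\<phi> :: real \<Rightarrow> 'n heis \<Rightarrow> 'n heis.
        (\<forall>t. heis_automorphism (\<phi> t)) \<and>
        (\<forall>g. \<phi> 0 g = g) \<and> (\<forall>s t g. \<phi> (s + t) g = \<phi> s (\<phi> t g)) \<and>
        (\<forall>g t. ((\<lambda>t. \<phi> t g) has_vector_derivative \<X> (\<phi> t g)) (at t)))"

definition derivation_of :: "('n::finite heis \<Rightarrow> 'n heis) \<Rightarrow> ('n heis \<Rightarrow> 'n heis) \<Rightarrow> ('n heis \<Rightarrow> 'n heis)"
  where "derivation_of \<X> V = - lie_bracket \<X> V"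

definition linear_system ::
    "('n::finite heis \<Rightarrow> 'n heis) \<Rightarrow> ('m::finite \<Rightarrow> 'n heis \<Rightarrow> 'n heis) \<Rightarrow> bool" where
  "linear_system \<X> B \<longleftrightarrow> linear_vector_field \<X> \<and> (\<forall>j. B j \<in> heis_algebra)"

definition system_field :: "('n::finite heis \<Rightarrow> 'n heis) \<Rightarrow> ('m::finite \<Rightarrow> 'n heis \<Rightarrow> 'n heis) \<Rightarrow>
    real^'m \<Rightarrow> 'n heis \<Rightarrow> 'n heis" where
  "system_field \<X> B u g = \<X> g + (\<Sum>j\<in>UNIV. (u $ j) *\<^sub>R B j g)"

definition admissible_input :: "(real \<Rightarrow> real^'m::finite) \<Rightarrow> bool" where
  "admissible_input u \<longleftrightarrow>
     u \<in> borel_measurable lebesgue \<and> (\<forall>K. compact K \<longrightarrow> bounded (u ` K))"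

text \<open>Solutions are in the sense of Caratheodory, written as an integral equation. Along a continuous
  curve the integrand is bounded and measurable on \<open>{0..T}\<close>, so that \<open>has_integral\<close> is the
  Lebesgue integral.\<close>

definition system_trajectory ::
    "('n::finite heis \<Rightarrow> 'n heis) \<Rightarrow> ('m::finite \<Rightarrow> 'n heis \<Rightarrow> 'n heis) \<Rightarrow>
     (real \<Rightarrow> real^'m) \<Rightarrow> real \<Rightarrow> (real \<Rightarrow> 'n heis) \<Rightarrow> bool" where
  "system_trajectory \<X> B u T \<gamma> \<longleftrightarrow>
     continuous_on {0..T} \<gamma> \<and>
     (\<forall>t \<in> {0..T}. ((\<lambda>s. system_field \<X> B (u s) (\<gamma> s)) has_integral (\<gamma> t - \<gamma> 0)) {0..t})"

definition controllable ::
    "('n::finite heis \<Rightarrow> 'n heis) \<Rightarrow> ('m::finite \<Rightarrow> 'n heis \<Rightarrow> 'n heis) \<Rightarrow> bool" where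
  "controllable \<X> B \<longleftrightarrow>
     (\<forall>g h. \<exists>T \<ge> 0. \<exists>u \<gamma>. admissible_input u \<and> system_trajectory \<X> B u T \<gamma> \<and> \<gamma> 0 = g \<and> \<gamma> T = h)"


text \<open>The bracket relations with \<open>Z \<noteq> 0\<close> force the \<open>2 n + 1\<close> fields to be pairwise distinct, so a basis
  as a set is the same as a basis as a family here.\<close>

definition symplectic_basis ::
    "('n::finite \<Rightarrow> 'n heis \<Rightarrow> 'n heis) \<Rightarrow> ('n \<Rightarrow> 'n heis \<Rightarrow> 'n heis) \<Rightarrow> ('n heis \<Rightarrow> 'n heis) \<Rightarrow> bool" where
  "symplectic_basis X Y Z \<longleftrightarrow>
     independent (range X \<union> range Y \<union> {Z}) \<and>
     span (range X \<union> range Y \<union> {Z}) = heis_algebra \<and>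
     (\<forall>i j. lie_bracket (X i) (Y j) = (if i = j then Z else 0)) \<and>
     (\<forall>i j. lie_bracket (X i) (X j) = 0) \<and>
     (\<forall>i j. lie_bracket (Y i) (Y j) = 0) \<and>
     (\<forall>i. lie_bracket (X i) Z = 0) \<and>
     (\<forall>i. lie_bracket (Y i) Z = 0)"

text \<open>\<open>\<psi> g = (x, y, z)\<close> are the coordinates of \<open>g\<close>, and the push-forwards by \<open>\<psi>\<close> of the basis fields
  are \<open>\<partial>/\<partial>x\<^sub>i\<close>, \<open>\<partial>/\<partial>y\<^sub>i + x\<^sub>i \<partial>/\<partial>z\<close> and \<open>\<partial>/\<partial>z\<close>.\<close>

definition associated_coordinates ::
    "('n::finite \<Rightarrow> 'n heis \<Rightarrow> 'n heis) \<Rightarrow> ('n \<Rightarrow> 'n heis \<Rightarrow> 'n heis) \<Rightarrow> ('n heis \<Rightarrow> 'n heis) \<Rightarrow>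
     ('n heis \<Rightarrow> 'n heis) \<Rightarrow> bool" where
  "associated_coordinates X Y Z \<psi> \<longleftrightarrow>
     heis_automorphism \<psi> \<and> \<psi> 0 = 0 \<and>
     (\<forall>g i. frechet_derivative \<psi> (at g) (X i g) = (axis i 1, 0, 0)) \<and>
     (\<forall>g i. frechet_derivative \<psi> (at g) (Y i g) = (0, axis i 1, fst (\<psi> g) $ i)) \<and>
     (\<forall>g. frechet_derivative \<psi> (at g) (Z g) = (0, 0, 1))"


definition quadratic_form :: "('a::real_vector \<Rightarrow> real) \<Rightarrow> bool" where
  "quadratic_form Q \<longleftrightarrow>
     (\<exists>b. bilinear b \<and> (\<forall>v w. b v w = b w v) \<and> (\<forall>v. Q v = b v v))"

definition polar_form :: "('a::real_vector \<Rightarrow> real) \<Rightarrow> 'a \<Rightarrow> 'a \<Rightarrow> real" where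
  "polar_form Q v w = (Q (v + w) - Q v - Q w) / 2"

definition quadratic_kernel :: "('a::real_vector \<Rightarrow> real) \<Rightarrow> 'a set" where
  "quadratic_kernel Q = {v. \<forall>w. polar_form Q v w = 0}"

text \<open>The equation \<open>dz/dt = d z + l(x, y) + Q(x, y)\<close> along the system: the derivative of the last
  coordinate in the direction of the system is the right-hand side, at every point and for every value
  \<open>u\<close> of the input.\<close>

definition last_coordinate_equation ::
    "('n::finite heis \<Rightarrow> 'n heis) \<Rightarrow> ('m::finite \<Rightarrow> 'n heis \<Rightarrow> 'n heis) \<Rightarrow> ('n heis \<Rightarrow> 'n heis) \<Rightarrow>
     real \<Rightarrow> ((real^'n) \<times> (real^'n) \<Rightarrow> real) \<Rightarrow> ((real^'n) \<times> (real^'n) \<Rightarrow> real) \<Rightarrow> bool" where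
  "last_coordinate_equation \<X> B \<psi> d l Q \<longleftrightarrow>
     (\<forall>g u. case \<psi> g of (x, y, z) \<Rightarrow>
        snd (snd (frechet_derivative \<psi> (at g) (system_field \<X> B u g))) = d * z + l (x, y) + Q (x, y))"

end

theory Submission
  imports Defs
begin

text \<open>
  Let \<open>F\<close> be the push-forward of \<open>\<X>\<close> by the coordinates \<open>\<psi>\<close>. Since \<open>F\<close> generates a flow of
  automorphisms, it is an infinitesimal automorphism: differentiating
  \<open>\<Phi>\<^sub>t (p q) = \<Phi>\<^sub>t p \<Phi>\<^sub>t q\<close> at \<open>t = 0\<close> expresses \<open>F (p q)\<close> through \<open>F p\<close> and \<open>F q\<close>.
  The eigenvalue equation \<open>D Z = d Z\<close> says that \<open>F (0, 0, z) = (0, 0, d z)\<close>. Hence the first two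
  components of \<open>F\<close> are additive in \<open>(x, y)\<close>, and the last one is \<open>d z\<close> plus a function of
  \<open>(x, y)\<close> whose failure to be additive is bilinear. By continuity, such a function is a linear
  form plus a quadratic form (\<open>infinitesimal_automorphism_last_component\<close>). The controlled fields
  lie in the span of the \<open>\<partial>/\<partial>x\<^sub>i\<close>, so they do not enter the last equation.

  For the obstruction, \<open>ker Q \<subseteq> ker l\<close> means that \<open>l\<close> is \<open>2 b(w, \<cdot>)\<close> for some \<open>w\<close>, where \<open>b\<close> is
  the polar form of \<open>Q\<close>. Completing the square, \<open>l + Q\<close> is at least \<open>- Q w\<close>
  (\<open>quadratic_plus_linear_bounded_below\<close>). So \<open>\<zeta> = z - Q w / d\<close> satisfies
  \<open>d\<zeta>/dt \<ge> d \<zeta>\<close> along every trajectory, that is, \<open>exp (- d t) \<zeta>\<close> is nondecreasing,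
  whatever the sign of \<open>d\<close>. The half-space \<open>\<zeta> \<ge> 0\<close> can never be left.

  A trajectory solves the system only in integrated form, and the ordinary chain rule does
  not apply to it. However, the rate of change of \<open>z\<close> does not depend on the input; this is enough
  for \<open>z\<close> to have a classical derivative at every time
  (\<open>has_vector_derivative_output\<close>).
\<close>

section \<open>Additive functions and quadratic forms\<close>

text \<open>Additivity gives homogeneity over the rationals, and the set of scalars for which
  homogeneity holds is closed.\<close>

lemma additive_continuous_imp_linear:
  fixes f :: "'a::real_normed_vector \<Rightarrow> 'b::real_normed_vector"
  assumes add: "\<And>v w. f (v + w) = f v + f w"
    and cont: "continuous_on UNIV f"
  shows "linear f"
proof (rule linearI)
  fix r :: real and v
  interpret additive f by standard (rule add)
  have nat: "f (real n *\<^sub>R w) = real n *\<^sub>R f w" for n w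
    by (induction n) (simp_all add: zero scaleR_add_left add)
  have int: "f (of_int k *\<^sub>R w) = of_int k *\<^sub>R f w" for k :: int and w
  proof (cases k rule: int_cases2)
    case (nonneg n) then show ?thesis by (simp add: nat)
  next
    case (nonpos n) then show ?thesis by (simp add: nat minus)
  qed
  let ?S = "{r. f (r *\<^sub>R v) = r *\<^sub>R f v}"
  have "\<rat> \<subseteq> ?S"
  proof
    fix q :: real assume "q \<in> \<rat>"
    then obtain a b :: int where b: "b \<noteq> 0" and q: "q = of_int a / of_int b"
      by (metis Rats_cases' less_irrefl)
    have "of_int b *\<^sub>R f (q *\<^sub>R v) = f (of_int a *\<^sub>R v)"
      using b by (simp add: q flip: int)
    also have "\<dots> = of_int b *\<^sub>R (q *\<^sub>R f v)"
      using b by (simp add: q int)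
    finally show "q \<in> ?S" using b unfolding scaleR_cancel_left by simp
  qed
  moreover have "closed ?S"
    by (intro closed_Collect_eq continuous_intros
        continuous_on_compose2 [OF cont, of _ "\<lambda>r. r *\<^sub>R v"]) auto
  ultimately have "closure \<rat> \<subseteq> ?S" by (rule closure_minimal)
  then show "f (r *\<^sub>R v) = r *\<^sub>R f v" by (auto simp: Rats_closure_real)
qed (rule add)

text \<open>A function that is additive up to a bilinear error \<open>b\<close> has its quadratic part given by
  half of \<open>b\<close>; the error is automatically symmetric.\<close>

lemma additive_up_to_bilinear:
  fixes f :: "'a::euclidean_space \<Rightarrow> real"
  assumes f: "\<And>v w. f (v + w) = f v + f w + b v w"
    and b: "bilinear b"
    and cont: "continuous_on UNIV f"
  shows "\<exists>l Q. linear l \<and> quadratic_form Q \<and> (\<forall>v. f v = l v + Q v)"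
proof -
  interpret bounded_bilinear b using b by (simp add: bilinear_conv_bounded_bilinear)
  have sym: "b v w = b w v" for v w
    using f [of v w] f [of w v] by (simp add: add.commute)
  define Q where "Q v = b v v / 2" for v
  have "bilinear (\<lambda>v w. b v w / 2)"
    using b by (auto simp: bilinear_def linear_iff add_divide_distrib)
  then have "quadratic_form Q"
    unfolding quadratic_form_def Q_def using sym by (intro exI [of _ "\<lambda>v w. b v w / 2"]) auto
  moreover have "linear (\<lambda>v. f v - Q v)"
  proof (rule additive_continuous_imp_linear)
    show "f (v + w) - Q (v + w) = f v - Q v + (f w - Q w)" for v w
      by (simp add: f Q_def add_left add_right sym [of w v] field_simps)
    show "continuous_on UNIV (\<lambda>v. f v - Q v)"
      unfolding Q_def by (intro continuous_intros cont continuous_on) auto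
  qed
  ultimately show ?thesis
    by (intro exI [of _ "\<lambda>v. f v - Q v"] exI [of _ Q]) auto
qed

text \<open>Let \<open>S\<close> be the symmetric operator representing the polar form. A linear form vanishing on
  \<open>ker S\<close> is represented by a vector orthogonal to \<open>ker S\<close>, that is, by a vector of the range of
  \<open>S\<close>. This makes it possible to complete the square.\<close>

lemma quadratic_plus_linear_bounded_below:
  fixes Q l :: "'a::euclidean_space \<Rightarrow> real"
  assumes "quadratic_form Q" and l: "linear l"
    and nonneg: "\<And>v. Q v \<ge> 0"
    and ker: "quadratic_kernel Q \<subseteq> {v. l v = 0}"
  shows "\<exists>C. \<forall>v. - C \<le> l v + Q v"
proof -
  obtain b where b: "bilinear b" and sym: "\<And>v w. b v w = b w v" and Q: "\<And>v. Q v = b v v"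
    using assms(1) unfolding quadratic_form_def by blast
  interpret bounded_bilinear b using b by (simp add: bilinear_conv_bounded_bilinear)
  have polar: "polar_form Q v w = b v w" for v w
    by (simp add: polar_form_def Q add_left add_right sym [of w v])
  define S where "S v = (\<Sum>i\<in>Basis. b v i *\<^sub>R i)" for v
  have linb: "linear (b v)" for v using b by (simp add: bilinear_def)
  have S: "S v \<bullet> w = b v w" for v w
  proof -
    have "b v w = b v (\<Sum>i\<in>Basis. (w \<bullet> i) *\<^sub>R i)" by (simp add: euclidean_representation)
    also have "\<dots> = S v \<bullet> w"
      by (simp add: linear_sum [OF linb] scaleR_right S_def inner_sum_left inner_commute [of w] mult.commute)
    finally show ?thesis ..
  qed
  have "linear S"
    by (rule linearI) (simp_all add: S_def add_left scaleR_left scaleR_add_left sum.distrib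
        scaleR_sum_right)
  then have sub: "subspace (range S)" by (simp add: linear_subspace_image)
  define a where "a = adjoint l 1"
  have a: "l v = a \<bullet> v" for v
    using adjoint_works [OF l, of v 1] by (simp add: a_def inner_commute)
  obtain y z where "y \<in> span (range S)" and orth: "\<And>w. w \<in> span (range S) \<Longrightarrow> orthogonal z w"
    and ayz: "a = y + z"
    using orthogonal_subspace_decomp_exists by blast
  then have y: "y \<in> range S" using sub by (simp add: span_eq_iff [THEN iffD2])
  have "b z w = 0" for w
    using orth [of "S w"] S [of w z] sym [of z w] by (simp add: span_base orthogonal_def inner_commute)
  then have "l z = 0" using ker by (auto simp: quadratic_kernel_def polar)
  then have "z = 0"
    using orth [of y] y by (simp add: a ayz span_base orthogonal_def inner_add_right inner_add_left inner_commute)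
  then obtain w where w: "a = 2 *\<^sub>R S w"
  proof -
    obtain w' where "y = S w'" using y by blast
    then have "a = 2 *\<^sub>R S ((1/2) *\<^sub>R w')"
      using \<open>z = 0\<close> ayz by (simp add: linear_scale [OF \<open>linear S\<close>])
    then show ?thesis by (rule that)
  qed
  have "- Q w \<le> l v + Q v" for v
  proof -
    have "Q (v + w) = Q v + l v + Q w"
      by (simp add: Q a w S add_left add_right sym [of v w])
    then show ?thesis using nonneg [of "v + w"] by simp
  qed
  then show ?thesis by blast
qed

section \<open>The Heisenberg group in its global chart\<close>

lemma heis_mult_components:
  "heis_mult p q = (fst p + fst q, fst (snd p) + fst (snd q),
     snd (snd p) + snd (snd q) + fst (snd p) \<bullet> fst q)"
  by (simp add: heis_mult_def split: prod.splits)

lemma has_vector_derivative_heis_mult: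
  assumes "(f has_vector_derivative f') (at t)" "(g has_vector_derivative g') (at t)"
  shows "((\<lambda>t. heis_mult (f t) (g t)) has_vector_derivative
     (fst f' + fst g', fst (snd f') + fst (snd g'),
      snd (snd f') + snd (snd g') + fst (snd f') \<bullet> fst (g t) + fst (snd (f t)) \<bullet> fst g')) (at t)"
  using assms unfolding has_vector_derivative_def heis_mult_components
  by (auto intro!: derivative_eq_intros simp: scaleR_add_right inner_commute algebra_simps)

lemma has_derivative_right_translation:
  "((\<lambda>k. heis_mult k g) has_derivative
    (\<lambda>v. (fst v, fst (snd v), snd (snd v) + fst (snd v) \<bullet> fst g))) (at h)"
  unfolding heis_mult_components by (auto intro!: derivative_eq_intros)

text \<open>A right-invariant field is determined by its value at the identity; in particular it is
  affine in the chart, hence continuous and differentiable.\<close>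

lemma right_invariant_formula:
  assumes "right_invariant V"
  shows "V g = (fst (V 0), fst (snd (V 0)), snd (snd (V 0)) + fst (snd (V 0)) \<bullet> fst g)"
proof -
  from fun_cong [OF frechet_derivative_at [OF has_derivative_right_translation], of "V 0" g 0]
  have "frechet_derivative (\<lambda>k. heis_mult k g) (at 0) (V 0) =
      (fst (V 0), fst (snd (V 0)), snd (snd (V 0)) + fst (snd (V 0)) \<bullet> fst g)" by simp
  moreover have "V g = frechet_derivative (\<lambda>k. heis_mult k g) (at 0) (V 0)"
    using assms [unfolded right_invariant_def, rule_format, of 0 g]
    by (simp add: heis_mult_components)
  ultimately show ?thesis by simp
qed

lemma right_invariant_continuous:
  assumes "right_invariant V"
  shows "continuous_on S V"
  by (subst right_invariant_formula [OF assms, abs_def]) (intro continuous_intros)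

lemma vertical_field_central:
  "(\<lambda>g. (0, 0, 1) :: 'n::finite heis) \<in> heis_center"
proof -
  have "right_invariant (\<lambda>g. (0, 0, 1) :: 'n heis)"
    unfolding right_invariant_def
  proof (rule allI, rule allI)
    fix g h :: "'n heis"
    from fun_cong [OF frechet_derivative_at [OF has_derivative_right_translation], of "(0, 0, 1)" g h]
    show "(0, 0, 1) = frechet_derivative (\<lambda>k. heis_mult k g) (at h) (0, 0, 1)" by simp
  qed
  moreover have "lie_bracket (\<lambda>g. (0, 0, 1)) W = 0" if "right_invariant W"
    for W :: "'n heis \<Rightarrow> 'n heis"
  proof
    fix g
    have "(W has_derivative (\<lambda>v. (0, 0, fst (snd (W 0)) \<bullet> fst v))) (at g)"
      by (subst right_invariant_formula [OF that, abs_def]) (auto intro!: derivative_eq_intros)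
    from fun_cong [OF frechet_derivative_at [OF this], of "(0, 0, 1)"]
    have "frechet_derivative W (at g) (0, 0, 1) = 0" by (simp add: zero_prod_def)
    then show "lie_bracket (\<lambda>g. (0, 0, 1)) W g = 0 g" by (simp add: lie_bracket_def)
  qed
  ultimately show ?thesis by (simp add: heis_center_def heis_algebra_def)
qed

section \<open>Infinitesimal automorphisms\<close>

text \<open>The infinitesimal form of \<open>\<Phi>\<^sub>t (p q) = \<Phi>\<^sub>t p \<Phi>\<^sub>t q\<close>.\<close>

definition infinitesimal_automorphism :: "('n::finite heis \<Rightarrow> 'n heis) \<Rightarrow> bool" where
  "infinitesimal_automorphism F \<longleftrightarrow> (\<forall>p q. F (heis_mult p q) =
     (fst (F p) + fst (F q), fst (snd (F p)) + fst (snd (F q)),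
      snd (snd (F p)) + snd (snd (F q)) + fst (snd (F p)) \<bullet> fst q + fst (snd p) \<bullet> fst (F q)))"

lemma infinitesimal_automorphism_of_flow:
  assumes hom: "\<And>t p q. \<Phi> t (heis_mult p q) = heis_mult (\<Phi> t p) (\<Phi> t q)"
    and init: "\<And>p. \<Phi> 0 p = p"
    and deriv: "\<And>p. ((\<lambda>t::real. \<Phi> t p) has_vector_derivative F p) (at 0)"
  shows "infinitesimal_automorphism F"
  unfolding infinitesimal_automorphism_def
proof (intro allI, rule vector_derivative_unique_at)
  fix p q
  show "((\<lambda>t. \<Phi> t (heis_mult p q)) has_vector_derivative F (heis_mult p q)) (at 0)"
    by (rule deriv)
  show "((\<lambda>t. \<Phi> t (heis_mult p q)) has_vector_derivative
     (fst (F p) + fst (F q), fst (snd (F p)) + fst (snd (F q)),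
      snd (snd (F p)) + snd (snd (F q)) + fst (snd (F p)) \<bullet> fst q + fst (snd p) \<bullet> fst (F q))) (at 0)"
    using has_vector_derivative_heis_mult [OF deriv [of p] deriv [of q]] by (simp add: hom init)
qed

lemma infinitesimal_automorphism_zero:
  assumes "infinitesimal_automorphism F"
  shows "F 0 = 0"
proof -
  have "heis_mult 0 0 = (0 :: 'a heis)" by (simp add: heis_mult_components zero_prod_def)
  then have "F 0 = F 0 + F 0"
    using assms [unfolded infinitesimal_automorphism_def, rule_format, of 0 0]
    by (simp add: plus_prod_def)
  then show ?thesis by (rule add_cancel_right_right [THEN iffD1])
qed

text \<open>Since \<open>F\<close> is vertical on the center, its first two components do not see \<open>z\<close>, and they are
  additive in \<open>(x, y)\<close>. The group cocycle \<open>y \<bullet> x'\<close> then makes the last component additive up to a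
  bilinear error.\<close>

lemma infinitesimal_automorphism_last_component:
  fixes F :: "'n::finite heis \<Rightarrow> 'n heis"
  assumes F: "infinitesimal_automorphism F"
    and cont: "continuous_on UNIV F"
    and vert: "\<And>z. F (0, 0, z) = (0, 0, d * z)"
  shows "\<exists>l Q. linear l \<and> quadratic_form Q \<and>
    (\<forall>x y z. snd (snd (F (x, y, z))) = d * z + l (x, y) + Q (x, y))"
proof -
  define E where "E v = F (fst v, snd v, 0)" for v :: "(real^'n) \<times> (real^'n)"
  have mult: "F (heis_mult p q) =
     (fst (F p) + fst (F q), fst (snd (F p)) + fst (snd (F q)),
      snd (snd (F p)) + snd (snd (F q)) + fst (snd (F p)) \<bullet> fst q + fst (snd p) \<bullet> fst (F q))"
    for p q using F unfolding infinitesimal_automorphism_def by blast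
  have Fz: "F (x, y, z) = E (x, y) + (0, 0, d * z)" for x y z
    using mult [of "(0, 0, z)" "(x, y, 0)"]
    by (simp add: heis_mult_components vert E_def prod_eq_iff)
  have E: "E (v + w) + (0, 0, d * (snd v \<bullet> fst w)) =
     (fst (E v) + fst (E w), fst (snd (E v)) + fst (snd (E w)),
      snd (snd (E v)) + snd (snd (E w)) + fst (snd (E v)) \<bullet> fst w + snd v \<bullet> fst (E w))" for v w
    using mult [of "(fst v, snd v, 0)" "(fst w, snd w, 0)"]
      Fz [of "fst v + fst w" "snd v + snd w" "snd v \<bullet> fst w"]
    by (simp add: heis_mult_components prod_eq_iff plus_prod_def E_def)
  have contE: "continuous_on UNIV E"
    unfolding E_def by (intro continuous_on_compose2 [OF cont] continuous_intros) auto
  have a: "linear (\<lambda>v. fst (E v))" and b: "linear (\<lambda>v. fst (snd (E v)))"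
    using E by (auto intro!: additive_continuous_imp_linear continuous_intros contE
        simp: prod_eq_iff)
  let ?b = "\<lambda>v w. fst (snd (E v)) \<bullet> fst w + snd v \<bullet> fst (E w) - d * (snd v \<bullet> fst w)"
  have "\<exists>l Q. linear l \<and> quadratic_form Q \<and> (\<forall>v. snd (snd (E v)) = l v + Q v)"
  proof (rule additive_up_to_bilinear)
    show "snd (snd (E (v + w))) = snd (snd (E v)) + snd (snd (E w)) + ?b v w" for v w
      using E [of v w] by (simp add: prod_eq_iff)
    show "bilinear ?b"
      using a b unfolding bilinear_def linear_iff
      by (auto simp: inner_add_left inner_add_right algebra_simps)
    show "continuous_on UNIV (\<lambda>v. snd (snd (E v)))" by (intro continuous_intros contE)
  qed
  then show ?thesis using Fz by (auto simp: add.commute add.left_commute)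
qed

section \<open>The equation of the last coordinate\<close>

lemma smooth_imp_differentiable: "smooth f \<Longrightarrow> f differentiable (at p)"
  unfolding smooth_def by (auto dest: spec [of _ "Suc 0"])

lemma smooth_imp_continuous_on: "smooth f \<Longrightarrow> continuous_on S f"
  by (meson continuous_at_imp_continuous_on differentiable_imp_continuous_within
      smooth_imp_differentiable)

lemma smooth_imp_has_derivative:
  "smooth f \<Longrightarrow> (f has_derivative frechet_derivative f (at p)) (at p)"
  by (simp add: smooth_imp_differentiable frechet_derivative_works [symmetric])

lemma smooth_imp_linear_derivative: "smooth f \<Longrightarrow> linear (frechet_derivative f (at p))"
  by (simp add: smooth_imp_differentiable linear_frechet_derivative)

lemma continuous_on_frechet_derivative:
  fixes f :: "'a::euclidean_space \<Rightarrow> 'b::euclidean_space"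
  assumes f: "smooth f" and g: "continuous_on S g" and v: "continuous_on S v"
  shows "continuous_on S (\<lambda>p. frechet_derivative f (at (g p)) (v p))"
proof -
  have expand: "frechet_derivative f (at p) w =
      (\<Sum>i\<in>Basis. (w \<bullet> i) *\<^sub>R frechet_derivative f (at p) i)" for p w
    using linear_sum [OF smooth_imp_linear_derivative [OF f, of p], of "\<lambda>i. (w \<bullet> i) *\<^sub>R i" Basis]
    by (simp add: euclidean_representation linear_scale [OF smooth_imp_linear_derivative [OF f]])
  have "continuous_on UNIV (\<lambda>p. frechet_derivative f (at p) i)" for i
    using f unfolding smooth_def by (auto dest: spec [of _ "Suc 0"])
  then show ?thesis
    by (subst expand) (intro continuous_intros v continuous_on_compose2 [OF _ g], auto)
qed

text \<open>Along the center both \<open>\<psi>\<close> and \<open>\<X>\<close> have a constant derivative, so they can be integrated.\<close>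

lemma constant_vertical_derivative:
  fixes f :: "'n::finite heis \<Rightarrow> 'n heis"
  assumes f: "smooth f" and c: "\<And>g. frechet_derivative f (at g) (0, 0, 1) = (0, 0, c)" and "f 0 = 0"
  shows "f (0, 0, t) = (0, 0, c * t)"
proof -
  let ?h = "\<lambda>t. f (0, 0, t) - (0, 0, c * t)"
  have "(?h has_vector_derivative 0) (at t)" for t
  proof -
    have "((\<lambda>t. (0, 0, t) :: 'n heis) has_vector_derivative (0, 0, 1)) (at t)"
      by (auto intro!: derivative_eq_intros simp: has_vector_derivative_def)
    from has_derivative_compose [OF this [unfolded has_vector_derivative_def]
        smooth_imp_has_derivative [OF f]]
    have "((\<lambda>t. f (0, 0, t)) has_vector_derivative (0, 0, c)) (at t)"
      by (simp only: has_vector_derivative_def linear_scale [OF smooth_imp_linear_derivative [OF f]] c)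
    moreover have "((\<lambda>t. (0, 0, c * t) :: 'n heis) has_vector_derivative (0, 0, c)) (at t)"
      by (auto intro!: derivative_eq_intros simp: has_vector_derivative_def)
    ultimately show ?thesis using has_vector_derivative_diff by fastforce
  qed
  then obtain k where "\<And>t. t \<in> UNIV \<Longrightarrow> ?h t = k"
    using has_vector_derivative_zero_constant [of UNIV ?h] by blast
  then have "?h t = ?h 0" by (metis UNIV_I)
  then have "?h t = 0" using \<open>f 0 = 0\<close> by (simp add: zero_prod_def)
  then show ?thesis by (rule eq_iff_diff_eq_0 [THEN iffD2])
qed

text \<open>The center is one-dimensional and contains \<open>\<partial>/\<partial>z\<close>, so \<open>Z\<close> is a constant multiple of
  \<open>\<partial>/\<partial>z\<close>. The bracket with \<open>Z\<close> is then a partial derivative, and \<open>\<psi>\<close> rescales the center.\<close>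

lemma last_coordinate_equation_exists:
  fixes \<X> :: "'n::finite heis \<Rightarrow> 'n heis"
    and B :: "'m::finite \<Rightarrow> 'n heis \<Rightarrow> 'n heis"
  assumes sys: "linear_system \<X> B"
    and center: "heis_center = span {Z}"
    and DZ: "derivation_of \<X> Z = d *\<^sub>R Z"
    and BX: "range B \<subseteq> span (range X)"
    and coord: "associated_coordinates X Y Z \<psi>"
  shows "\<exists>l Q. linear l \<and> quadratic_form Q \<and> last_coordinate_equation \<X> B \<psi> d l Q"
proof -
  have \<X>: "smooth \<X>" using sys by (simp add: linear_system_def linear_vector_field_def)
  obtain \<phi> where \<phi>: "\<And>t. heis_automorphism (\<phi> t)" and \<phi>0: "\<And>g. \<phi> 0 g = g"
    and flow: "\<And>g t. ((\<lambda>t. \<phi> t g) has_vector_derivative \<X> (\<phi> t g)) (at t)"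
    using sys unfolding linear_system_def linear_vector_field_def by auto
  have \<psi>: "smooth \<psi>" "bij \<psi>" "smooth (inv \<psi>)" "\<psi> 0 = 0"
    and hom: "\<And>g h. \<psi> (heis_mult g h) = heis_mult (\<psi> g) (\<psi> h)"
    and \<psi>X: "\<And>g i. frechet_derivative \<psi> (at g) (X i g) = (axis i 1, 0, 0)"
    and \<psi>Z: "\<And>g. frechet_derivative \<psi> (at g) (Z g) = (0, 0, 1)"
    using coord by (auto simp: associated_coordinates_def heis_automorphism_def)
  have inv_\<psi>: "inv \<psi> (\<psi> g) = g" "\<psi> (inv \<psi> g) = g" for g
    using \<psi>(2) by (simp_all add: bij_is_inj bij_is_surj surj_f_inv_f)
  have lin: "linear (frechet_derivative \<psi> (at g))" for g
    by (rule smooth_imp_linear_derivative [OF \<psi>(1)])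

  obtain r where r: "(\<lambda>g. (0, 0, 1)) = r *\<^sub>R Z"
    using vertical_field_central [where 'n = 'n] center by (auto simp: span_singleton)
  have rZ: "r *\<^sub>R Z g = (0, 0, 1)" for g using fun_cong [OF r, of g] by simp
  then have "r \<noteq> 0" by (metis scaleR_zero_left zero_neq_one prod.inject zero_prod_def)
  have Z: "Z = (\<lambda>g. (0, 0, 1 / r))"
  proof
    fix g
    have "Z g = (1 / r) *\<^sub>R (r *\<^sub>R Z g)" using \<open>r \<noteq> 0\<close> by simp
    then show "Z g = (0, 0, 1 / r)" unfolding rZ by simp
  qed
  have vec: "(0, 0, 1) = r *\<^sub>R (0 :: real^'n, 0 :: real^'n, 1 / r)" using \<open>r \<noteq> 0\<close> by simp

  have "frechet_derivative \<psi> (at g) (0, 0, 1) = (0, 0, r)" for g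
    using \<psi>Z [of g] unfolding vec linear_scale [OF lin] by (simp add: Z)
  then have \<psi>_vert: "\<psi> (0, 0, t) = (0, 0, r * t)" for t
    by (intro constant_vertical_derivative \<psi>)

  have "infinitesimal_automorphism \<X>"
    using \<phi> by (intro infinitesimal_automorphism_of_flow [of \<phi>])
      (auto simp: heis_automorphism_def \<phi>0 intro: flow [where t = 0, unfolded \<phi>0])
  then have "\<X> 0 = 0" by (rule infinitesimal_automorphism_zero)
  moreover have "frechet_derivative \<X> (at g) (0, 0, 1) = (0, 0, d)" for g
  proof -
    have "frechet_derivative \<X> (at g) (Z g) = d *\<^sub>R Z g"
      using fun_cong [OF DZ, of g] by (simp add: derivation_of_def lie_bracket_def Z)
    then show ?thesis
      unfolding vec linear_scale [OF smooth_imp_linear_derivative [OF \<X>]] using \<open>r \<noteq> 0\<close>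
      by (simp add: Z)
  qed
  ultimately have \<X>_vert: "\<X> (0, 0, t) = (0, 0, d * t)" for t
    by (intro constant_vertical_derivative \<X>)

  \<comment> \<open>the push-forward of \<open>\<X>\<close> by \<open>\<psi>\<close>, generating the flow \<open>\<psi> \<circ> \<phi> t \<circ> inv \<psi>\<close>\<close>
  define F where "F p = frechet_derivative \<psi> (at (inv \<psi> p)) (\<X> (inv \<psi> p))" for p
  have "infinitesimal_automorphism F"
  proof (rule infinitesimal_automorphism_of_flow [of "\<lambda>t p. \<psi> (\<phi> t (inv \<psi> p))"])
    fix t p q
    have "inv \<psi> (heis_mult p q) = heis_mult (inv \<psi> p) (inv \<psi> q)"
      by (metis hom inv_\<psi>)
    then show "\<psi> (\<phi> t (inv \<psi> (heis_mult p q))) = heis_mult (\<psi> (\<phi> t (inv \<psi> p))) (\<psi> (\<phi> t (inv \<psi> q)))"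
      using \<phi> unfolding heis_automorphism_def by (metis hom)
  next
    fix p
    show "((\<lambda>t. \<psi> (\<phi> t (inv \<psi> p))) has_vector_derivative F p) (at 0)"
      using has_derivative_compose [OF flow [where t = 0 and g = "inv \<psi> p", unfolded \<phi>0 has_vector_derivative_def],
          of \<psi> "frechet_derivative \<psi> (at (inv \<psi> p))"] smooth_imp_has_derivative [OF \<psi>(1)]
      by (simp add: \<phi>0 has_vector_derivative_def F_def linear_scale [OF lin])
  qed (simp add: \<phi>0 inv_\<psi>)
  moreover have "continuous_on UNIV F"
    unfolding F_def
    by (intro continuous_on_frechet_derivative \<psi> smooth_imp_continuous_on
        continuous_on_compose2 [OF smooth_imp_continuous_on [OF \<X>]]) auto
  moreover have "F (0, 0, z) = (0, 0, d * z)" for z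
  proof -
    have "inv \<psi> (0, 0, z) = (0, 0, z / r)"
      by (metis \<psi>_vert inv_\<psi>(1) \<open>r \<noteq> 0\<close> nonzero_mult_div_cancel_left times_divide_eq_right)
    then have "F (0, 0, z) = frechet_derivative \<psi> (at (0, 0, z / r)) ((d * z) *\<^sub>R Z (0, 0, z / r))"
      by (simp add: F_def \<X>_vert Z)
    then show ?thesis by (simp add: linear_scale [OF lin] \<psi>Z)
  qed
  ultimately obtain l Q where l: "linear l" and Q: "quadratic_form Q"
    and F: "\<And>x y z. snd (snd (F (x, y, z))) = d * z + l (x, y) + Q (x, y)"
    using infinitesimal_automorphism_last_component by blast

  have B0: "snd (snd (frechet_derivative \<psi> (at g) (V g))) = 0" if "V \<in> span (range X)" for V g
    using that
    by (induction rule: span_induct_alt)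
      (auto simp: linear_0 [OF lin] linear_add [OF lin] linear_scale [OF lin] \<psi>X)
  have "snd (snd (frechet_derivative \<psi> (at g) (system_field \<X> B u g))) =
      snd (snd (frechet_derivative \<psi> (at g) (\<X> g)))" for g u
    using BX by (simp add: system_field_def linear_add [OF lin] linear_sum [OF lin] linear_scale [OF lin]
        snd_sum B0 image_subset_iff)
  moreover have "snd (snd (frechet_derivative \<psi> (at g) (\<X> g))) = (case \<psi> g of (x, y, z) \<Rightarrow>
      d * z + l (x, y) + Q (x, y))" for g
    using F [of "fst (\<psi> g)" "fst (snd (\<psi> g))" "snd (snd (\<psi> g))"]
    by (simp add: F_def inv_\<psi> split: prod.splits)
  ultimately have "last_coordinate_equation \<X> B \<psi> d l Q"
    by (auto simp: last_coordinate_equation_def split: prod.splits)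
  then show ?thesis using l Q by blast
qed

section \<open>Outputs along trajectories\<close>

text \<open>The chain rule at a time \<open>s\<close> for a curve \<open>\<gamma>\<close> that is only an integral of a bounded
  function \<open>f\<close>. The curve is Lipschitz, so that the first-order remainder of \<open>h\<close> is \<open>o(t - s)\<close>; and
  \<open>L \<circ> \<gamma>\<close> is differentiable at \<open>s\<close> as soon as \<open>L \<circ> f\<close> is continuous there, even
  if \<open>f\<close> is not.\<close>

lemma has_vector_derivative_output:
  fixes \<gamma> f :: "real \<Rightarrow> 'a::euclidean_space" and h :: "'a \<Rightarrow> real"
  assumes int: "\<And>t. t \<in> {0..T} \<Longrightarrow> (f has_integral (\<gamma> t - \<gamma> 0)) {0..t}"
    and bd: "\<And>t. t \<in> {0..T} \<Longrightarrow> norm (f t) \<le> M"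
    and s: "s \<in> {0..T}"
    and h: "(h has_derivative L) (at (\<gamma> s))"
    and cont: "continuous (at s within {0..T}) (\<lambda>r. L (f r))"
  shows "((\<lambda>t. h (\<gamma> t)) has_vector_derivative L (f s)) (at s within {0..T})"
proof -
  have L: "bounded_linear L" using h by (rule has_derivative_bounded_linear)
  have M: "0 \<le> M" using bd [OF s] norm_ge_zero order_trans by blast
  have lip0: "norm (\<gamma> t - \<gamma> r) \<le> M * (t - r)" if "0 \<le> r" "r \<le> t" "t \<le> T" for r t
  proof -
    have "f integrable_on {0..t}" using int [of t] that by auto
    then have "integral {0..r} f + integral {r..t} f = integral {0..t} f"
      using that by (intro Henstock_Kurzweil_Integration.integral_combine) auto
    moreover have "integral {0..r} f = \<gamma> r - \<gamma> 0" "integral {0..t} f = \<gamma> t - \<gamma> 0"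
      using int [of r] int [of t] that by (auto intro: integral_unique)
    ultimately have "integral {r..t} f = \<gamma> t - \<gamma> r" by (simp add: algebra_simps)
    moreover have "f integrable_on {r..t}"
      using \<open>f integrable_on {0..t}\<close> by (rule integrable_on_subinterval) (use that in auto)
    ultimately have "(f has_integral (\<gamma> t - \<gamma> r)) (cbox r t)"
      by (simp add: has_integral_iff)
    from has_integral_bound [OF M this] bd that show ?thesis by auto
  qed
  have lip: "norm (\<gamma> t - \<gamma> s) \<le> M * norm (t - s)" if "t \<in> {0..T}" for t
    using lip0 [of s t] lip0 [of t s] s that
    by (cases "s \<le> t") (auto simp: norm_minus_commute)

  have Lint: "((\<lambda>r. L (f r)) has_integral L (\<gamma> t - \<gamma> 0)) {0..t}" if "t \<in> {0..T}" for t
    using has_integral_linear [OF int [OF that] L] by (simp add: o_def)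
  have "(\<lambda>r. L (f r)) integrable_on {0..T}" using Lint [of T] s by auto
  then have "((\<lambda>t. integral {0..t} (\<lambda>r. L (f r))) has_vector_derivative L (f s)) (at s within {0..T})"
    using integral_has_vector_derivative_continuous_at [of "\<lambda>r. L (f r)" 0 T s "{}"] s cont by simp
  then have "((\<lambda>t. L (\<gamma> t - \<gamma> 0)) has_vector_derivative L (f s)) (at s within {0..T})"
    by (rule has_vector_derivative_transform [OF s, rotated])
      (use Lint in \<open>auto intro: integral_unique [symmetric]\<close>)
  from has_vector_derivative_add [OF this has_vector_derivative_const [of "L (\<gamma> 0 - \<gamma> s)"]]
  have lin: "((\<lambda>t. L (\<gamma> t - \<gamma> s)) has_vector_derivative L (f s)) (at s within {0..T})"
    by (simp flip: linear_add [OF bounded_linear.linear [OF L]])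

  \<comment> \<open>the remainder is at most \<open>e / (M + 1)\<close> times the increment of \<open>\<gamma>\<close>; dividing by \<open>M + 1\<close>
    rather than by the Lipschitz constant \<open>M\<close> covers \<open>M = 0\<close>\<close>
  have "((\<lambda>t. h (\<gamma> t) - L (\<gamma> t - \<gamma> s)) has_vector_derivative 0) (at s within {0..T})"
    unfolding has_vector_derivative_def has_derivative_within_alt
  proof (intro conjI allI impI)
    fix e :: real assume "e > 0"
    then have "e / (M + 1) > 0" using M by simp
    then obtain \<delta> where \<delta>: "\<delta> > 0"
      and rem: "\<And>p. norm (p - \<gamma> s) < \<delta> \<Longrightarrow>
        norm (h p - h (\<gamma> s) - L (p - \<gamma> s)) \<le> e / (M + 1) * norm (p - \<gamma> s)"
      using h unfolding has_derivative_at_alt by meson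
    show "\<exists>\<eta>>0. \<forall>t\<in>{0..T}. norm (t - s) < \<eta> \<longrightarrow>
      norm (h (\<gamma> t) - L (\<gamma> t - \<gamma> s) - (h (\<gamma> s) - L (\<gamma> s - \<gamma> s)) - (t - s) *\<^sub>R 0) \<le> e * norm (t - s)"
    proof (intro exI [of _ "\<delta> / (M + 1)"] conjI ballI impI)
      show "\<delta> / (M + 1) > 0" using \<delta> M by simp
      fix t assume t: "t \<in> {0..T}" "norm (t - s) < \<delta> / (M + 1)"
      have "norm (\<gamma> t - \<gamma> s) \<le> (M + 1) * norm (t - s)"
        using lip [OF t(1)] by (rule order_trans) (simp add: mult_right_mono)
      moreover have "(M + 1) * norm (t - s) < \<delta>" using t(2) M by (simp add: field_simps)
      ultimately have "norm (h (\<gamma> t) - h (\<gamma> s) - L (\<gamma> t - \<gamma> s)) \<le> e / (M + 1) * ((M + 1) * norm (t - s))"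
        using rem [of "\<gamma> t"] \<open>e / (M + 1) > 0\<close>
        by (smt (verit) mult_left_mono)
      also have "\<dots> = e * norm (t - s)" using M by simp
      finally show "norm (h (\<gamma> t) - L (\<gamma> t - \<gamma> s) - (h (\<gamma> s) - L (\<gamma> s - \<gamma> s)) - (t - s) *\<^sub>R 0)
          \<le> e * norm (t - s)"
        by (simp add: linear_0 [OF bounded_linear.linear [OF L]] algebra_simps)
    qed
  qed simp
  from has_vector_derivative_add [OF this lin] show ?thesis by simp
qed

text \<open>If the derivative of \<open>h\<close> kills the controlled fields, then \<open>L \<circ> f\<close> is continuous at \<open>s\<close>
  although the input is not: the discontinuous terms are a bounded input times a factor that tends
  to \<open>0\<close>.\<close>

lemma uncontrolled_output_derivative:
  fixes \<X> :: "'n::finite heis \<Rightarrow> 'n heis"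
    and B :: "'m::finite \<Rightarrow> 'n heis \<Rightarrow> 'n heis"
    and h :: "'n heis \<Rightarrow> real"
  assumes \<X>: "continuous_on UNIV \<X>" and B: "\<And>j. continuous_on UNIV (B j)"
    and u: "admissible_input u" and traj: "system_trajectory \<X> B u T \<gamma>"
    and s: "s \<in> {0..T}"
    and h: "(h has_derivative L) (at (\<gamma> s))"
    and kill: "\<And>j. L (B j (\<gamma> s)) = 0"
  shows "((\<lambda>t. h (\<gamma> t)) has_vector_derivative L (\<X> (\<gamma> s))) (at s within {0..T})"
proof -
  have L: "bounded_linear L" using h by (rule has_derivative_bounded_linear)
  have lin: "linear L" using L by (rule bounded_linear.linear)
  have \<gamma>: "continuous_on {0..T} \<gamma>"
    and int: "\<And>t. t \<in> {0..T} \<Longrightarrow>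
      ((\<lambda>s. system_field \<X> B (u s) (\<gamma> s)) has_integral (\<gamma> t - \<gamma> 0)) {0..t}"
    using traj by (auto simp: system_trajectory_def)
  have \<X>\<gamma>: "continuous_on {0..T} (\<lambda>r. \<X> (\<gamma> r))"
    and B\<gamma>: "\<And>j. continuous_on {0..T} (\<lambda>r. B j (\<gamma> r))"
    using continuous_on_compose2 [OF \<X> \<gamma>] continuous_on_compose2 [OF B \<gamma>] by auto

  have "bounded (u ` {0..T})" using u by (simp add: admissible_input_def)
  then obtain K where K: "\<And>r. r \<in> {0..T} \<Longrightarrow> norm (u r) \<le> K"
    unfolding bounded_iff by blast
  then have Kj: "\<bar>u r $ j\<bar> \<le> K" if "r \<in> {0..T}" for r j
    using component_le_norm_cart order_trans that by blast
  have "bounded ((\<lambda>r. \<X> (\<gamma> r)) ` {0..T})"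
    by (intro compact_imp_bounded compact_continuous_image \<X>\<gamma>) auto
  then obtain M0 where M0: "\<And>r. r \<in> {0..T} \<Longrightarrow> norm (\<X> (\<gamma> r)) \<le> M0"
    unfolding bounded_iff by blast
  have "\<exists>c. \<forall>r\<in>{0..T}. norm (B j (\<gamma> r)) \<le> c" for j
  proof -
    have "bounded ((\<lambda>r. B j (\<gamma> r)) ` {0..T})"
      by (intro compact_imp_bounded compact_continuous_image B\<gamma>) auto
    then show ?thesis unfolding bounded_iff by blast
  qed
  then obtain c where c: "\<And>r j. r \<in> {0..T} \<Longrightarrow> norm (B j (\<gamma> r)) \<le> c j" by metis
  have K0: "0 \<le> K" using K [OF s] norm_ge_zero order_trans by blast
  have bd: "norm (system_field \<X> B (u r) (\<gamma> r)) \<le> M0 + (\<Sum>j\<in>UNIV. K * c j)" if "r \<in> {0..T}" for r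
    unfolding system_field_def
    by (intro norm_triangle_mono sum_norm_le M0 that)
      (auto intro!: mult_mono Kj c that K0)

  have L_field: "L (system_field \<X> B v g) = L (\<X> g) + (\<Sum>j\<in>UNIV. v $ j * L (B j g))" for v g
    by (simp add: system_field_def linear_add [OF lin] linear_sum [OF lin] linear_scale [OF lin])
  have at_s: "L (system_field \<X> B (u s) (\<gamma> s)) = L (\<X> (\<gamma> s))"
    by (simp add: L_field kill)
  have lim: "((\<lambda>r. L (V (\<gamma> r))) \<longlongrightarrow> L (V (\<gamma> s))) (at s within {0..T})"
    if "continuous_on {0..T} (\<lambda>r. V (\<gamma> r))" for V :: "'n heis \<Rightarrow> 'n heis"
    using that s by (auto intro!: bounded_linear.tendsto [OF L] simp: continuous_on_def)
  have "((\<lambda>r. u r $ j * L (B j (\<gamma> r))) \<longlongrightarrow> 0) (at s within {0..T})" for j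
  proof (rule Lim_null_comparison)
    show "eventually (\<lambda>r. norm (u r $ j * L (B j (\<gamma> r))) \<le> K * \<bar>L (B j (\<gamma> r))\<bar>) (at s within {0..T})"
      by (auto simp: eventually_at_topological abs_mult intro!: mult_right_mono Kj)
    show "((\<lambda>r. K * \<bar>L (B j (\<gamma> r))\<bar>) \<longlongrightarrow> 0) (at s within {0..T})"
      using lim [OF B\<gamma> [of j]] by (auto simp: kill intro!: tendsto_eq_intros)
  qed
  then have "((\<lambda>r. L (system_field \<X> B (u r) (\<gamma> r))) \<longlongrightarrow> L (\<X> (\<gamma> s)) + (\<Sum>j\<in>(UNIV::'m set). 0))
      (at s within {0..T})"
    unfolding L_field by (intro tendsto_add tendsto_sum lim \<X>\<gamma>) auto
  then have "continuous (at s within {0..T}) (\<lambda>r. L (system_field \<X> B (u r) (\<gamma> r)))"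
    by (simp add: continuous_within at_s)
  from has_vector_derivative_output [OF int bd s h this] show ?thesis by (simp add: at_s)
qed

section \<open>The obstruction to controllability\<close>

text \<open>The integrating factor \<open>exp (- d t)\<close> turns the inequality into monotonicity, for either sign
  of \<open>d\<close>.\<close>

lemma differential_inequality_nonneg:
  fixes \<zeta> :: "real \<Rightarrow> real"
  assumes deriv: "\<And>t. t \<in> {0..T} \<Longrightarrow> (\<zeta> has_vector_derivative \<zeta>' t) (at t within {0..T})"
    and ge: "\<And>t. t \<in> {0..T} \<Longrightarrow> d * \<zeta> t \<le> \<zeta>' t"
    and "0 \<le> \<zeta> 0" and "0 \<le> T"
  shows "0 \<le> \<zeta> T"
proof (cases "T = 0")
  case True
  then show ?thesis using assms by simp
next
  case False
  then have "0 < T" using assms by simp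
  have "((\<lambda>t. exp (- d * t) * \<zeta> t) has_derivative
      (\<lambda>x. x * (exp (- d * t) * (\<zeta>' t - d * \<zeta> t)))) (at t within {0..T})" if "0 \<le> t" "t \<le> T" for t
  proof -
    have "(\<zeta> has_derivative (\<lambda>x. x * \<zeta>' t)) (at t within {0..T})"
      using deriv [of t] that by (simp add: has_vector_derivative_def)
    then show ?thesis by (auto intro!: derivative_eq_intros simp: algebra_simps)
  qed
  from mvt_simple [OF \<open>0 < T\<close> this] obtain t where t: "t \<in> {0<..<T}"
    and eq: "exp (- d * T) * \<zeta> T - exp (- d * 0) * \<zeta> 0 =
      (T - 0) * (exp (- d * t) * (\<zeta>' t - d * \<zeta> t))" by blast
  have "0 \<le> (T - 0) * (exp (- d * t) * (\<zeta>' t - d * \<zeta> t))"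
    using ge [of t] t by (intro mult_nonneg_nonneg) auto
  then have "0 \<le> exp (- d * T) * \<zeta> T" using eq \<open>0 \<le> \<zeta> 0\<close> by simp
  then show ?thesis by (simp add: zero_le_mult_iff)
qed

text \<open>The half-space \<open>z \<ge> C / d\<close> is forward invariant: along
  every trajectory \<open>dz/dt \<ge> d z - C = d (z - C / d)\<close>. A boundary point therefore cannot be steered to a point
  below it.\<close>

lemma not_controllable_if_bounded_below:
  fixes \<X> :: "'n::finite heis \<Rightarrow> 'n heis"
    and B :: "'m::finite \<Rightarrow> 'n heis \<Rightarrow> 'n heis"
  assumes sys: "linear_system \<X> B" and "smooth \<psi>" "surj \<psi>" and "d \<noteq> 0"
    and eq: "last_coordinate_equation \<X> B \<psi> d l Q"
    and C: "\<And>v. - C \<le> l v + Q v"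
  shows "\<not> controllable \<X> B"
proof
  assume "controllable \<X> B"
  define c where "c = C / d"
  obtain g1 g2 where g: "\<psi> g1 = (0, 0, c)" "\<psi> g2 = (0, 0, c - 1)"
    using \<open>surj \<psi>\<close> by (metis surj_def)
  obtain T u \<gamma> where T: "T \<ge> 0" and u: "admissible_input u" and traj: "system_trajectory \<X> B u T \<gamma>"
    and ends: "\<gamma> 0 = g1" "\<gamma> T = g2"
    using \<open>controllable \<X> B\<close> unfolding controllable_def by meson
  have \<X>: "continuous_on UNIV \<X>"
    using sys by (simp add: linear_system_def linear_vector_field_def smooth_imp_continuous_on)
  have B: "continuous_on UNIV (B j)" for j
    using sys by (intro right_invariant_continuous) (simp add: linear_system_def heis_algebra_def)
  define L where "L g v = snd (snd (frechet_derivative \<psi> (at g) v))" for g v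
  have lin: "linear (L g)" for g
    using linear_compose [OF smooth_imp_linear_derivative [OF \<open>smooth \<psi>\<close>, of g],
        of "\<lambda>p. snd (snd p)"] unfolding L_def o_def by (simp add: linear_iff)
  have h: "((\<lambda>p. snd (snd (\<psi> p))) has_derivative L g) (at g)" for g
    unfolding L_def by (intro has_derivative_snd smooth_imp_has_derivative \<open>smooth \<psi>\<close>)
  define R where "R g = d * snd (snd (\<psi> g)) + l (fst (\<psi> g), fst (snd (\<psi> g)))
      + Q (fst (\<psi> g), fst (snd (\<psi> g)))" for g
  have R: "L g (system_field \<X> B v g) = R g" for g v
    using eq [unfolded last_coordinate_equation_def, rule_format, of g v]
    by (simp add: L_def R_def case_prod_beta)
  have LX: "L g (\<X> g) = R g" for g
    using R [of g 0] by (simp add: system_field_def)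
  \<comment> \<open>comparing the unit input along \<open>B j\<close> with the zero input\<close>
  have LB: "L g (B j g) = 0" for g j
  proof -
    have "system_field \<X> B (axis j 1) g = \<X> g + (\<Sum>i\<in>UNIV. if i = j then B i g else 0)"
      unfolding system_field_def by (intro arg_cong2 [where f = "(+)"] sum.cong) (auto simp: axis_def)
    then have "system_field \<X> B (axis j 1) g = \<X> g + B j g" by simp
    then show ?thesis using R [of g "axis j 1"] LX [of g] by (simp add: linear_add [OF lin])
  qed
  have "0 \<le> snd (snd (\<psi> (\<gamma> T))) - c"
  proof (rule differential_inequality_nonneg [of T "\<lambda>t. snd (snd (\<psi> (\<gamma> t))) - c" "\<lambda>t. R (\<gamma> t)" d])
    fix t assume t: "t \<in> {0..T}"
    show "((\<lambda>t. snd (snd (\<psi> (\<gamma> t))) - c) has_vector_derivative R (\<gamma> t)) (at t within {0..T})"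
      using has_vector_derivative_diff [OF uncontrolled_output_derivative [OF \<X> B u traj t h LB]
          has_vector_derivative_const [of c]] by (simp add: LX)
    show "d * (snd (snd (\<psi> (\<gamma> t))) - c) \<le> R (\<gamma> t)"
      using C [of "(fst (\<psi> (\<gamma> t)), fst (snd (\<psi> (\<gamma> t))))"] \<open>d \<noteq> 0\<close>
      by (simp add: R_def c_def algebra_simps)
  qed (use T g ends in auto)
  then show False by (simp add: ends g)
qed

theorem theorem4:
  fixes \<X> :: "'n::finite heis \<Rightarrow> 'n heis"
    and B :: "'m::finite \<Rightarrow> 'n heis \<Rightarrow> 'n heis"
    and X Y :: "'n \<Rightarrow> 'n heis \<Rightarrow> 'n heis"
    and Z :: "'n heis \<Rightarrow> 'n heis"
    and \<psi> :: "'n heis \<Rightarrow> 'n heis"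
    and d :: real
  assumes "linear_system \<X> B"
    and "heis_center = span {Z}"
    and "derivation_of \<X> Z = d *\<^sub>R Z"
    and "Z \<notin> lie_subalgebra hull (range B)"
    and "d \<noteq> 0"
    and "symplectic_basis X Y Z"
    and "range B \<subseteq> span (range X)"
    and "associated_coordinates X Y Z \<psi>"
  shows "(\<exists>l Q. linear l \<and> quadratic_form Q \<and> last_coordinate_equation \<X> B \<psi> d l Q) \<and>
    (\<forall>l Q. linear l \<and> quadratic_form Q \<and> last_coordinate_equation \<X> B \<psi> d l Q \<and>
       (\<forall>v. Q v \<ge> 0) \<and> quadratic_kernel Q \<subseteq> {v. l v = 0} \<longrightarrow>
       \<not> controllable \<X> B)"
proof (intro conjI allI impI)
  show "\<exists>l Q. linear l \<and> quadratic_form Q \<and> last_coordinate_equation \<X> B \<psi> d l Q"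
    using assms by (intro last_coordinate_equation_exists)
next
  fix l Q
  assume *: "linear l \<and> quadratic_form Q \<and> last_coordinate_equation \<X> B \<psi> d l Q \<and>
       (\<forall>v. Q v \<ge> 0) \<and> quadratic_kernel Q \<subseteq> {v. l v = 0}"
  then obtain C where "\<And>v. - C \<le> l v + Q v"
    using quadratic_plus_linear_bounded_below [of Q l] by blast
  moreover have "smooth \<psi>" "surj \<psi>"
    using assms by (auto simp: associated_coordinates_def heis_automorphism_def bij_is_surj)
  ultimately show "\<not> controllable \<X> B"
    using assms * not_controllable_if_bounded_below by blast
qed

end
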